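(* Let $\Omega\subset\mathbb{R}^n$, $n\ge1$, be a bounded domain with Lipschitz boundary, let $G$ and $H$ be Young functions satisfying the $\Delta'$ condition, with $H\prec\prec G^*$ in case $T_g=\infty$, and let $w$ be an admissible weight (as defined in the context). For $\mu>0$ let $$\lambda_{1,\mu}:=\inf\left\{\frac{\int_\Omega G(|\nabla u|)\,dx}{\int_\Omega wH(|u|)\,dx}:u\in W^{1,G}_0(\Omega),\ \int_\Omega wH(|u|)\,dx=\mu\right\}.$$ Given $0<\mu_1<\mu_2$, we have $$\mu_1\lambda_{1,\mu_1}\le\mu_2\lambda_{1,\mu_2}.$$
   Context: Young functions. A Young function is a map $G:[0,\infty)\to[0,\infty)$ of the form $G(t)=\int_0^t g(s)\,ds$ with $g=G'$ right-continuous on $[0,\infty)$, $g(0)=0$, $g(t)>0$ for $t>0$, $g$ nondecreasing, and $\lim_{t\to\infty}g(t)=\infty$. The Young functions $G,H$ are normalized by $G(1)=H(1)=1$, have absolutely continuous derivatives, and satisfy, for constants $1\le p^-\le p^+<\infty$, $p^-\le \frac{tG'(t)}{G(t)}\le p^+$ for all $t>0$ (same for $H$). $G$ satisfies the $\Delta'$ condition if there is a constant $C\ge 1$ with $G(ab)\le C\,G(a)G(b)$ for all $a,b\ge0$. The complementary function is $\tilde G(t)=\sup\{ta-G(a): a>0\}$. Order. $G\prec H$ means there are $k>0$ and $t_0\ge0$ with $G(t)\le H(kt)$ for all $t\ge t_0$. $G\prec\prec H$ means $\lim_{t\to\infty}G(t)/H(kt)=0$ for all $k>0$. Critical function. $T_g:=\int_1^\infty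 \frac{G^{-1}(s)}{s^{1+1/n}}\,ds$, and $G^*$ is defined by $(G^* )^{-1}(t)=\int_0^t\frac{G^{-1}(s)}{s^{1+1/n}}\,ds$. Admissible weight. $w$ is non-negative, not a.e. zero, and: if $T_g<\infty$, then $w\in L^\infty(\Omega)$; if $T_g=\infty$ (and $H\prec\prec G^*$), then $w\in L^\infty(\Omega)$ or, more generally, $w\in L^{\tilde B}(\Omega)$ for some Young function $B$ with $B\prec A:=G^*\circ G^{-1}$. Spaces. $\|u\|_G=\inf\{\delta>0:\int_\Omega G(|u|/\delta)\,dx\le1\}$; $L^G(\Omega)$ is the set of measurable $u$ with $\int_\Omega G(|u|)\,dx<\infty$; $W^{1,G}(\Omega)=\{u\in L^G(\Omega):|\nabla u|\in L^G(\Omega)\}$ and $W^{1,G}_0(\Omega)$ is the closure of $C_c^\infty(\Omega)$ in $W^{1,G}(\Omega)$ for the norm $\|u\|_G+\|\nabla u\|_G$. *)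

theory Defs
  imports "HOL-Analysis.Analysis"
begin

text \<open>Functions on \<open>[0,\<infinity>)\<close> are represented by total functions on the reals; only their values on
  \<open>[0,\<infinity>)\<close> are ever used. Integrals and other quantities that may be infinite live in \<open>ennreal\<close>.\<close>

section \<open>Young functions\<close>

definition young_density :: "(real \<Rightarrow> real) \<Rightarrow> (real \<Rightarrow> real) \<Rightarrow> bool" where
  "young_density G g \<longleftrightarrow>
     (\<forall>t\<ge>0. continuous (at_right t) g) \<and> g 0 = 0 \<and> (\<forall>t>0. g t > 0) \<and>
     mono_on {0..} g \<and> filterlim g at_top at_top \<and>
     (\<forall>t\<ge>0. (g has_integral G t) {0..t})"

definition young_function :: "(real \<Rightarrow> real) \<Rightarrow> bool" where
  "young_function G \<longleftrightarrow> (\<exists>g. young_density G g)"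

definition abs_continuous_on_interval :: "real \<Rightarrow> real \<Rightarrow> (real \<Rightarrow> real) \<Rightarrow> bool" where
  "abs_continuous_on_interval a b f \<longleftrightarrow>
     (\<forall>\<epsilon>>0. \<exists>\<delta>>0. \<forall>I :: (real \<times> real) set.
        finite I \<and> (\<forall>(c, d)\<in>I. a \<le> c \<and> c \<le> d \<and> d \<le> b) \<and>
        pairwise (\<lambda>p q. disjnt {fst p<..<snd p} {fst q<..<snd q}) I \<and>
        (\<Sum>(c, d)\<in>I. d - c) < \<delta>
        \<longrightarrow> (\<Sum>(c, d)\<in>I. \<bar>f d - f c\<bar>) < \<epsilon>)"

text \<open>The standing assumptions on \<open>G\<close> and \<open>H\<close>. Absolute continuity of \<open>g = G'\<close> on the unbounded
  interval \<open>[0,\<infinity>)\<close> means absolute continuity on every \<open>[0,b]\<close>.\<close>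

definition normalized_young :: "(real \<Rightarrow> real) \<Rightarrow> bool" where
  "normalized_young G \<longleftrightarrow>
     (\<exists>g. young_density G g \<and> G 1 = 1 \<and>
        (\<forall>b>0. abs_continuous_on_interval 0 b g) \<and>
        (\<exists>pm pp. 1 \<le> pm \<and> pm \<le> pp \<and> (\<forall>t>0. pm \<le> t * g t / G t \<and> t * g t / G t \<le> pp)))"

definition Delta_prime :: "(real \<Rightarrow> real) \<Rightarrow> bool" where
  "Delta_prime G \<longleftrightarrow> (\<exists>C\<ge>1. \<forall>a\<ge>0. \<forall>b\<ge>0. G (a * b) \<le> C * G a * G b)"

definition young_conj :: "(real \<Rightarrow> real) \<Rightarrow> real \<Rightarrow> real" where
  "young_conj G t = (SUP a\<in>{0<..}. t * a - G a)"

text \<open>The orders are stated for \<open>ennreal\<close>-valued functions because the critical function may be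
  infinite.\<close>

definition young_le :: "(real \<Rightarrow> ennreal) \<Rightarrow> (real \<Rightarrow> ennreal) \<Rightarrow> bool" where
  "young_le F K \<longleftrightarrow> (\<exists>k>0. \<exists>t0\<ge>0. \<forall>t\<ge>t0. F t \<le> K (k * t))"

definition young_less :: "(real \<Rightarrow> ennreal) \<Rightarrow> (real \<Rightarrow> ennreal) \<Rightarrow> bool" where
  "young_less F K \<longleftrightarrow> (\<forall>k>0. ((\<lambda>t. F t / K (k * t)) \<longlongrightarrow> 0) at_top)"

definition young_inv :: "(real \<Rightarrow> real) \<Rightarrow> real \<Rightarrow> real" where
  "young_inv G = inv_into {0..} G"

definition T_crit :: "nat \<Rightarrow> (real \<Rightarrow> real) \<Rightarrow> ennreal" where
  "T_crit n G = (\<integral>\<^sup>+s\<in>{1..}. ennreal (young_inv G s / s powr (1 + 1 / real n)) \<partial>lborel)"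

definition crit_inv :: "nat \<Rightarrow> (real \<Rightarrow> real) \<Rightarrow> real \<Rightarrow> ennreal" where
  "crit_inv n G t = (\<integral>\<^sup>+s\<in>{0..t}. ennreal (young_inv G s / s powr (1 + 1 / real n)) \<partial>lborel)"

text \<open>The generalized inverse of \<^term>\<open>crit_inv n G\<close>. It is the ordinary inverse when
  \<^term>\<open>crit_inv n G\<close> is a bijection of \<open>[0,\<infinity>)\<close>. If the defining integral
  diverges at \<open>0\<close>, it vanishes identically, and then no Young function \<open>H\<close> satisfies
  \<^term>\<open>young_less H (crit_fun n G)\<close> (as \<open>x / 0 = \<infinity>\<close> in \<open>ennreal\<close> for \<open>x > 0\<close>).\<close>

definition crit_fun :: "nat \<Rightarrow> (real \<Rightarrow> real) \<Rightarrow> real \<Rightarrow> ennreal" where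
  "crit_fun n G t = Sup {ennreal s | s. 0 \<le> s \<and> crit_inv n G s \<le> ennreal t}"

section \<open>Orlicz and Orlicz--Sobolev spaces\<close>

text \<open>Elements of function spaces are represented by functions on the whole space, of which only the
  values on \<open>\<Omega>\<close>, up to null sets, matter.\<close>

definition modular :: "'a::euclidean_space set \<Rightarrow> (real \<Rightarrow> real) \<Rightarrow> ('a \<Rightarrow> real) \<Rightarrow> ennreal" where
  "modular \<Omega> G u = (\<integral>\<^sup>+x. ennreal (G \<bar>u x\<bar>) \<partial>lebesgue_on \<Omega>)"

definition orlicz :: "'a::euclidean_space set \<Rightarrow> (real \<Rightarrow> real) \<Rightarrow> ('a \<Rightarrow> real) set" where
  "orlicz \<Omega> G = {u \<in> borel_measurable (lebesgue_on \<Omega>). modular \<Omega> G u < \<infinity>}"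

definition lux_norm :: "'a::euclidean_space set \<Rightarrow> (real \<Rightarrow> real) \<Rightarrow> ('a \<Rightarrow> real) \<Rightarrow> ennreal" where
  "lux_norm \<Omega> G u = Inf {ennreal \<delta> | \<delta>. 0 < \<delta> \<and> modular \<Omega> G (\<lambda>x. u x / \<delta>) \<le> 1}"

definition L_infty :: "'a::euclidean_space set \<Rightarrow> ('a \<Rightarrow> real) set" where
  "L_infty \<Omega> = {u \<in> borel_measurable (lebesgue_on \<Omega>). \<exists>C. AE x in lebesgue_on \<Omega>. \<bar>u x\<bar> \<le> C}"

fun Ck :: "nat \<Rightarrow> ('a::euclidean_space \<Rightarrow> real) \<Rightarrow> bool" where
  "Ck 0 f \<longleftrightarrow> continuous_on UNIV f"
| "Ck (Suc k) f \<longleftrightarrow> (\<forall>x. f differentiable (at x)) \<and>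
     (\<forall>b\<in>Basis. Ck k (\<lambda>x. frechet_derivative f (at x) b))"

definition test_fun :: "'a::euclidean_space set \<Rightarrow> ('a \<Rightarrow> real) set" where
  "test_fun \<Omega> = {\<phi>. (\<forall>k. Ck k \<phi>) \<and> compact (closure {x. \<phi> x \<noteq> 0}) \<and> closure {x. \<phi> x \<noteq> 0} \<subseteq> \<Omega>}"

definition grad :: "('a::euclidean_space \<Rightarrow> real) \<Rightarrow> 'a \<Rightarrow> 'a" where
  "grad \<phi> x = (\<Sum>b\<in>Basis. frechet_derivative \<phi> (at x) b *\<^sub>R b)"

definition loc_integrable :: "'a::euclidean_space set \<Rightarrow> ('a \<Rightarrow> 'b::euclidean_space) \<Rightarrow> bool" where
  "loc_integrable \<Omega> f \<longleftrightarrow> (\<forall>K. compact K \<and> K \<subseteq> \<Omega> \<longrightarrow> integrable (lebesgue_on K) f)"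

text \<open>\<open>v\<close> is (a representative of) the distributional gradient \<open>\<nabla>u\<close> on \<open>\<Omega>\<close>; it is unique up to null
  sets, so all quantities below do not depend on its choice.\<close>

definition weak_grad :: "'a::euclidean_space set \<Rightarrow> ('a \<Rightarrow> real) \<Rightarrow> ('a \<Rightarrow> 'a) \<Rightarrow> bool" where
  "weak_grad \<Omega> u v \<longleftrightarrow> loc_integrable \<Omega> u \<and> loc_integrable \<Omega> v \<and>
     (\<forall>\<phi>\<in>test_fun \<Omega>. \<forall>b\<in>Basis.
        (LINT x|lebesgue_on \<Omega>. u x * (grad \<phi> x \<bullet> b)) = - (LINT x|lebesgue_on \<Omega>. (v x \<bullet> b) * \<phi> x))"

definition W1 :: "'a::euclidean_space set \<Rightarrow> (real \<Rightarrow> real) \<Rightarrow> ('a \<Rightarrow> real) set" where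
  "W1 \<Omega> G = {u \<in> orlicz \<Omega> G. \<exists>v. weak_grad \<Omega> u v \<and> (\<lambda>x. norm (v x)) \<in> orlicz \<Omega> G}"

definition W1_0 :: "'a::euclidean_space set \<Rightarrow> (real \<Rightarrow> real) \<Rightarrow> ('a \<Rightarrow> real) set" where
  "W1_0 \<Omega> G = {u \<in> W1 \<Omega> G. \<exists>v. weak_grad \<Omega> u v \<and>
     (\<forall>\<epsilon>>0. \<exists>\<phi>\<in>test_fun \<Omega>.
        lux_norm \<Omega> G (\<lambda>x. u x - \<phi> x) + lux_norm \<Omega> G (\<lambda>x. norm (v x - grad \<phi> x)) < ennreal \<epsilon>)}"

section \<open>Domains, weights and the eigenvalue\<close>

text \<open>Near each boundary point, \<open>\<Omega>\<close> is the region above the graph of a Lipschitz function \<open>\<gamma>\<close> defined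
  on the hyperplane orthogonal to some unit vector \<open>e\<close>.\<close>

definition lipschitz_boundary :: "'a::euclidean_space set \<Rightarrow> bool" where
  "lipschitz_boundary \<Omega> \<longleftrightarrow>
     (\<forall>x0\<in>frontier \<Omega>. \<exists>r>0. \<exists>e \<gamma> L. norm e = 1 \<and> L-lipschitz_on {y. y \<bullet> e = 0} \<gamma> \<and>
        \<Omega> \<inter> ball x0 r = {x \<in> ball x0 r. \<gamma> (x - (x \<bullet> e) *\<^sub>R e) < x \<bullet> e})"

definition bounded_lipschitz_domain :: "'a::euclidean_space set \<Rightarrow> bool" where
  "bounded_lipschitz_domain \<Omega> \<longleftrightarrow>
     open \<Omega> \<and> connected \<Omega> \<and> \<Omega> \<noteq> {} \<and> bounded \<Omega> \<and> lipschitz_boundary \<Omega>"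

definition admissible_weight ::
  "'a::euclidean_space set \<Rightarrow> (real \<Rightarrow> real) \<Rightarrow> ('a \<Rightarrow> real) \<Rightarrow> bool" where
  "admissible_weight \<Omega> G w \<longleftrightarrow>
     (AE x in lebesgue_on \<Omega>. 0 \<le> w x) \<and> \<not> (AE x in lebesgue_on \<Omega>. w x = 0) \<and>
     (if T_crit DIM('a) G < \<infinity> then w \<in> L_infty \<Omega>
      else w \<in> L_infty \<Omega> \<or>
        (\<exists>B. young_function B \<and>
             young_le (\<lambda>t. ennreal (B t)) (\<lambda>t. crit_fun DIM('a) G (young_inv G t)) \<and>
             w \<in> orlicz \<Omega> (young_conj B)))"

definition weighted_modular ::
  "'a::euclidean_space set \<Rightarrow> ('a \<Rightarrow> real) \<Rightarrow> (real \<Rightarrow> real) \<Rightarrow> ('a \<Rightarrow> real) \<Rightarrow> ennreal" where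
  "weighted_modular \<Omega> w H u = (\<integral>\<^sup>+x. ennreal (w x * H \<bar>u x\<bar>) \<partial>lebesgue_on \<Omega>)"

definition lambda1 ::
  "'a::euclidean_space set \<Rightarrow> (real \<Rightarrow> real) \<Rightarrow> (real \<Rightarrow> real) \<Rightarrow> ('a \<Rightarrow> real) \<Rightarrow> real \<Rightarrow> ennreal" where
  "lambda1 \<Omega> G H w \<mu> =
     Inf {modular \<Omega> G (\<lambda>x. norm (v x)) / weighted_modular \<Omega> w H u | u v.
            u \<in> W1_0 \<Omega> G \<and> weak_grad \<Omega> u v \<and> weighted_modular \<Omega> w H u = ennreal \<mu>}"

end

theory Submission
  imports Defs
begin

text \<open>Given \<open>u\<close> admissible for \<open>\<mu>\<^sub>2\<close>, the map \<open>t \<mapsto> \<integral> w H(t|u|)\<close> is continuous on \<open>[0,1]\<close> and runs from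
  \<open>0\<close> to \<open>\<mu>\<^sub>2\<close>, so some \<open>t u\<close> with \<open>0 < t \<le> 1\<close> is admissible for \<open>\<mu>\<^sub>1\<close>; since \<open>G\<close> is
  nondecreasing, its numerator \<open>\<integral> G(t|\<nabla>u|)\<close> does not exceed \<open>\<integral> G(|\<nabla>u|)\<close>.\<close>

section \<open>Elementary properties of Young functions\<close>

lemma young_function_zero:
  assumes "young_function G"
  shows "G 0 = 0"
proof -
  from assms obtain g where g: "\<forall>t\<ge>0. (g has_integral G t) {0..t}"
    unfolding young_function_def young_density_def by blast
  then have "(g has_integral G 0) {0..0}" by blast
  then show ?thesis
    by (metis has_integral_refl(2) has_integral_unique cbox_interval cbox_idem)
qed

lemma young_function_mono:
  assumes "young_function G"
  shows "mono_on {0..} G"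
proof (rule mono_onI)
  fix s t :: real
  assume "s \<in> {0..}" "t \<in> {0..}" "s \<le> t"
  from assms obtain g where g: "\<forall>t\<ge>0. (g has_integral G t) {0..t}"
    and "g 0 = 0" "\<forall>t>0. g t > 0"
    unfolding young_function_def young_density_def by blast
  \<comment> \<open>\<open>g 0 = 0\<close> covers the endpoint 0, where strict positivity says
    nothing. With g nonnegative, enlarging the interval can only increase the integral.\<close>
  then have "0 \<le> g x" if "x \<in> {0..t}" for x
    using that by (metis atLeastAtMost_iff order.order_iff_strict)
  moreover have "{0..s} \<subseteq> {0..t}" using \<open>s \<le> t\<close> by simp
  ultimately show "G s \<le> G t"
    using has_integral_subset_le[of "{0..s}" "{0..t}" g "G s" "G t"] g
      \<open>s \<in> {0..}\<close> \<open>t \<in> {0..}\<close> by simp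
qed

lemma young_function_nonneg:
  assumes "young_function G" and "0 \<le> t"
  shows "0 \<le> G t"
  using mono_onD[OF young_function_mono[OF assms(1)], of 0 t] young_function_zero[OF assms(1)] assms(2)
  by simp

text \<open>An indefinite integral is continuous on every compact interval \<open>{0..b}\<close>,
  and continuity is local.\<close>

lemma young_function_continuous_on:
  assumes "young_function G"
  shows "continuous_on {0..} G"
proof -
  from assms obtain g where g: "\<And>t. 0 \<le> t \<Longrightarrow> (g has_integral G t) {0..t}"
    unfolding young_function_def young_density_def by blast
  have cont: "continuous_on {0..b} G" if "0 \<le> b" for b
  proof -
    have "continuous_on {0..b} (\<lambda>t. integral {0..t} g)"
      using g[OF that] by (intro indefinite_integral_continuous_1) blast
    then show ?thesis
      by (rule continuous_on_eq) (simp add: g integral_unique)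
  qed
  show ?thesis
    unfolding continuous_on_eq_continuous_within
  proof
    fix t :: real
    assume t: "t \<in> {0..}"
    then have "continuous (at t within {0..t+1}) G"
      using cont[of "t+1"] by (simp add: continuous_on_eq_continuous_within)
    \<comment> \<open>The right endpoint t+1 leaves room beyond t, so the interval and the half-line
      agree in a neighbourhood of t.\<close>
    moreover have "at t within {0..t+1} = at t within {0..}"
      by (rule at_within_nhd[where S = "{..<t+1}"]) auto
    ultimately show "continuous (at t within {0..}) G" by simp
  qed
qed

section \<open>Contraction by a factor in [0,1]: modulars and Luxemburg norms\<close>

lemma modular_scale_le:
  assumes "young_function G" and "0 \<le> c" "c \<le> 1"
  shows "modular \<Omega> G (\<lambda>x. c * u x) \<le> modular \<Omega> G u"
  unfolding modular_def
proof (intro nn_integral_mono ennreal_leI mono_onD[OF young_function_mono[OF assms(1)]])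
  fix x
  show "\<bar>c * u x\<bar> \<le> \<bar>u x\<bar>"
    using assms by (simp add: abs_mult mult_left_le_one_le)
qed auto

lemma orlicz_scale:
  assumes "young_function G" and "0 \<le> c" "c \<le> 1" and "u \<in> orlicz \<Omega> G"
  shows "(\<lambda>x. c * u x) \<in> orlicz \<Omega> G"
proof -
  have "(\<lambda>x. c * u x) \<in> borel_measurable (lebesgue_on \<Omega>)"
    using assms(4) unfolding orlicz_def by (intro borel_measurable_times) auto
  then show ?thesis
    using assms(4) modular_scale_le[OF assms(1-3), of \<Omega> u]
    unfolding orlicz_def by (auto intro: le_less_trans)
qed

text \<open>Every \<delta> that competes in the norm of u also competes in the norm of cu, so the
  second infimum is over a larger set.\<close>

lemma lux_norm_scale_le:
  assumes "young_function G" and "0 \<le> c" "c \<le> 1"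
  shows "lux_norm \<Omega> G (\<lambda>x. c * u x) \<le> lux_norm \<Omega> G u"
  unfolding lux_norm_def
proof (rule Inf_superset_mono, clarify)
  fix \<delta> :: real
  assume "0 < \<delta>" and le: "modular \<Omega> G (\<lambda>x. u x / \<delta>) \<le> 1"
  have "modular \<Omega> G (\<lambda>x. c * u x / \<delta>) \<le> 1"
    using order_trans[OF modular_scale_le[OF assms, of \<Omega> "\<lambda>x. u x / \<delta>"] le] by simp
  then show "\<exists>\<delta>'. ennreal \<delta> = ennreal \<delta>' \<and> 0 < \<delta>' \<and> modular \<Omega> G (\<lambda>x. c * u x / \<delta>') \<le> 1"
    using \<open>0 < \<delta>\<close> by blast
qed

section \<open>Scaling of test functions, weak gradients and Sobolev functions\<close>

lemma frechet_derivative_scale: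
  fixes f :: "'a::real_normed_vector \<Rightarrow> real"
  assumes "f differentiable (at x)"
  shows "frechet_derivative (\<lambda>x. c * f x) (at x) = (\<lambda>h. c * frechet_derivative f (at x) h)"
  by (rule frechet_derivative_at[OF has_derivative_mult_right, symmetric])
     (use assms frechet_derivative_works in blast)

text \<open>The induction hypothesis is applied to the partial derivatives of f, hence the
  generalization over f.\<close>

lemma Ck_scale: "Ck k f \<Longrightarrow> Ck k (\<lambda>x. c * f x)"
  by (induction k arbitrary: f)
     (auto simp: frechet_derivative_scale intro!: continuous_intros)

lemma test_fun_differentiable:
  assumes "\<phi> \<in> test_fun \<Omega>"
  shows "\<phi> differentiable (at x)"
proof -
  have "Ck (Suc 0) \<phi>"
    using assms unfolding test_fun_def by blast
  then show ?thesis by simp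
qed

lemma test_fun_scale:
  assumes "\<phi> \<in> test_fun \<Omega>" and "c \<noteq> 0"
  shows "(\<lambda>x. c * \<phi> x) \<in> test_fun \<Omega>"
  using assms unfolding test_fun_def by (auto simp: Ck_scale)

lemma grad_scale:
  assumes "\<phi> differentiable (at x)"
  shows "grad (\<lambda>x. c * \<phi> x) x = c *\<^sub>R grad \<phi> x"
  using assms by (simp add: grad_def frechet_derivative_scale scaleR_sum_right)

lemma weak_grad_scale:
  assumes "weak_grad \<Omega> u v"
  shows "weak_grad \<Omega> (\<lambda>x. c * u x) (\<lambda>x. c *\<^sub>R v x)"
  using assms unfolding weak_grad_def loc_integrable_def
  by (auto simp: mult.assoc)

lemma W1_scale:
  assumes "young_function G" and "0 \<le> c" "c \<le> 1" and "u \<in> W1 \<Omega> G"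
  shows "(\<lambda>x. c * u x) \<in> W1 \<Omega> G"
proof -
  obtain v where v: "weak_grad \<Omega> u v" "(\<lambda>x. norm (v x)) \<in> orlicz \<Omega> G"
    using assms(4) unfolding W1_def by blast
  have "(\<lambda>x. norm (c *\<^sub>R v x)) \<in> orlicz \<Omega> G"
    using orlicz_scale[OF assms(1-3) v(2)] assms(2) by simp
  then show ?thesis
    using weak_grad_scale[OF v(1)] orlicz_scale[OF assms(1-3)] assms(4)
    unfolding W1_def by blast
qed

text \<open>If a test function \<phi> approximates u, then c\<phi> approximates cu: both errors get
  multiplied by c, so their norms do not grow and the same \<epsilon> works.\<close>

lemma W1_0_scale:
  assumes "young_function G" and c: "0 < c" "c \<le> 1" and "u \<in> W1_0 \<Omega> G"
  shows "(\<lambda>x. c * u x) \<in> W1_0 \<Omega> G"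
proof -
  have c0: "0 \<le> c" using c by simp
  obtain v where v: "weak_grad \<Omega> u v"
    and approx: "\<And>\<epsilon>. \<epsilon> > 0 \<Longrightarrow> \<exists>\<phi>\<in>test_fun \<Omega>. lux_norm \<Omega> G (\<lambda>x. u x - \<phi> x)
      + lux_norm \<Omega> G (\<lambda>x. norm (v x - grad \<phi> x)) < ennreal \<epsilon>"
    using assms(4) unfolding W1_0_def by blast
  have "\<exists>\<psi>\<in>test_fun \<Omega>. lux_norm \<Omega> G (\<lambda>x. c * u x - \<psi> x)
      + lux_norm \<Omega> G (\<lambda>x. norm (c *\<^sub>R v x - grad \<psi> x)) < ennreal \<epsilon>" if \<epsilon>: "\<epsilon> > 0" for \<epsilon>
  proof -
    obtain \<phi> where \<phi>: "\<phi> \<in> test_fun \<Omega>" and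
      less: "lux_norm \<Omega> G (\<lambda>x. u x - \<phi> x) + lux_norm \<Omega> G (\<lambda>x. norm (v x - grad \<phi> x)) < ennreal \<epsilon>"
      using approx[OF \<epsilon>] by blast
    let ?\<psi> = "\<lambda>x. c * \<phi> x"
    have "(\<lambda>x. c * u x - ?\<psi> x) = (\<lambda>x. c * (u x - \<phi> x))"
      by (simp add: right_diff_distrib)
    moreover have "(\<lambda>x. norm (c *\<^sub>R v x - grad ?\<psi> x)) = (\<lambda>x. c * norm (v x - grad \<phi> x))"
    proof
      fix x
      have "c *\<^sub>R v x - grad ?\<psi> x = c *\<^sub>R (v x - grad \<phi> x)"
        by (simp add: grad_scale[OF test_fun_differentiable[OF \<phi>]] scaleR_diff_right)
      then show "norm (c *\<^sub>R v x - grad ?\<psi> x) = c * norm (v x - grad \<phi> x)"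
        using c0 by simp
    qed
    ultimately have "lux_norm \<Omega> G (\<lambda>x. c * u x - ?\<psi> x)
      + lux_norm \<Omega> G (\<lambda>x. norm (c *\<^sub>R v x - grad ?\<psi> x))
      \<le> lux_norm \<Omega> G (\<lambda>x. u x - \<phi> x) + lux_norm \<Omega> G (\<lambda>x. norm (v x - grad \<phi> x))"
      by (simp only:) (intro add_mono lux_norm_scale_le[OF assms(1) c0 c(2)])
    then show ?thesis
      using less test_fun_scale[OF \<phi>] c by (intro bexI[of _ ?\<psi>]) auto
  qed
  then show ?thesis
    using W1_scale[OF assms(1) c0 c(2)] weak_grad_scale[OF v] assms(4)
    unfolding W1_0_def by blast
qed

section \<open>Measurability of compositions and continuity of the weighted modular along
  rays\<close>

lemma young_function_comp_measurable:
  assumes "young_function H" and "u \<in> borel_measurable M"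
  shows "(\<lambda>x. H \<bar>u x\<bar>) \<in> borel_measurable M"
proof -
  \<comment> \<open>The absolute value keeps the argument in \<open>{0..}\<close>, where H is known
    to be continuous.\<close>
  have "continuous_on UNIV (\<lambda>s. H \<bar>s\<bar>)"
    by (intro continuous_on_compose2[OF young_function_continuous_on[OF assms(1)]] continuous_intros) auto
  then have "(\<lambda>s. H \<bar>s\<bar>) \<in> borel_measurable borel"
    by (rule borel_measurable_continuous_onI)
  from measurable_compose[OF assms(2) this] show ?thesis .
qed

text \<open>Dominated convergence makes the weighted modular of tu continuous in t; the intermediate
  value theorem then yields c.\<close>

lemma weighted_modular_intermediate:
  assumes H: "young_function H"
    and w[measurable]: "w \<in> borel_measurable (lebesgue_on \<Omega>)" and w0: "AE x in lebesgue_on \<Omega>. 0 \<le> w x"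
    and u[measurable]: "u \<in> borel_measurable (lebesgue_on \<Omega>)"
    and \<nu>: "weighted_modular \<Omega> w H u = ennreal \<nu>" and \<mu>: "0 < \<mu>" "\<mu> \<le> \<nu>"
  obtains c where "0 < c" "c \<le> 1" "weighted_modular \<Omega> w H (\<lambda>x. c * u x) = ennreal \<mu>"
proof -
  \<comment> \<open>F is a real-valued version of the weighted modular along the ray; finiteness at
    t = 1 will make it agree with the modular on [0,1] (\<open>wm\<close>).\<close>
  define f where "f = (\<lambda>t x. w x * H \<bar>t * u x\<bar>)"
  define F where "F = (\<lambda>t. integral\<^sup>L (lebesgue_on \<Omega>) (f t))"
  have meas[measurable]: "f t \<in> borel_measurable (lebesgue_on \<Omega>)" for t
    unfolding f_def
    by (intro borel_measurable_times w young_function_comp_measurable[OF H] borel_measurable_const u)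
  have pos: "AE x in lebesgue_on \<Omega>. 0 \<le> f t x" for t
    using w0 by eventually_elim (simp add: f_def young_function_nonneg[OF H])
  have int1: "integrable (lebesgue_on \<Omega>) (f 1)"
    using \<nu> by (intro integrableI_nonneg meas pos) (simp add: f_def weighted_modular_def)
  \<comment> \<open>Since H is nondecreasing, \<open>f 1\<close> is one integrable majorant for all
    t in [0,1]. The bound holds only almost everywhere because w may be negative on a null
    set.\<close>
  have dom: "AE x in lebesgue_on \<Omega>. norm (f t x) \<le> f 1 x" if "t \<in> {0..1}" for t
    using w0
  proof eventually_elim
    case (elim x)
    have "\<bar>t * u x\<bar> \<le> \<bar>u x\<bar>"
      using that by (simp add: abs_mult mult_left_le_one_le)
    then have "H \<bar>t * u x\<bar> \<le> H \<bar>u x\<bar>"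
      by (intro mono_onD[OF young_function_mono[OF H]]) auto
    then show ?case
      using elim by (simp add: f_def abs_mult young_function_nonneg[OF H] mult_left_mono)
  qed
  have int: "integrable (lebesgue_on \<Omega>) (f t)" if "t \<in> {0..1}" for t
    using meas dom[OF that] by (intro Bochner_Integration.integrable_bound[OF int1]) auto
  have wm: "weighted_modular \<Omega> w H (\<lambda>x. t * u x) = ennreal (F t)" if "t \<in> {0..1}" for t
    using nn_integral_eq_integral[OF int[OF that] pos] by (simp add: weighted_modular_def F_def f_def)
  \<comment> \<open>Sequential continuity is the form in which dominated convergence
    applies.\<close>
  have "continuous_on {0..1} F"
    unfolding continuous_on_sequentially comp_def
  proof (intro allI ballI impI)
    fix s :: "nat \<Rightarrow> real" and a
    assume a: "a \<in> {0..1}" and s: "(\<forall>n. s n \<in> {0..1}) \<and> s \<longlonglongrightarrow> a"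
    have cont: "continuous_on UNIV (\<lambda>t. f t x)" for x
      unfolding f_def
      by (intro continuous_intros continuous_on_compose2[OF young_function_continuous_on[OF H]]) auto
    have "(\<lambda>n. f (s n) x) \<longlonglongrightarrow> f a x" for x
      using s by (intro continuous_on_tendsto_compose[OF cont]) auto
    then show "(\<lambda>n. F (s n)) \<longlonglongrightarrow> F a"
      unfolding F_def
      by (intro integral_dominated_convergence[OF meas meas int1]) (use dom s in auto)
  qed
  moreover have "F 0 = 0"
    by (simp add: F_def f_def young_function_zero[OF H])
  \<comment> \<open>\<open>ennreal\<close> sends all negative reals to 0, so comparing the real
    values requires both to be nonnegative.\<close>
  moreover have "F 1 = \<nu>"
    using wm[of 1] \<nu> \<mu> integral_nonneg_AE[OF pos[of 1]] by (simp add: F_def)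
  ultimately obtain c where c: "0 \<le> c" "c \<le> 1" "F c = \<mu>"
    using IVT'[of F 0 \<mu> 1] \<mu> by auto
  \<comment> \<open>Strict positivity of c is a hypothesis of \<open>W1_0_scale\<close>.\<close>
  then have "c \<noteq> 0"
    using \<open>F 0 = 0\<close> \<mu> by auto
  then show ?thesis
    using that[of c] c wm[of c] by auto
qed

section \<open>Comparison of the infima for \<open>\<mu>\<^sub>1\<close> and
  \<open>\<mu>\<^sub>2\<close>\<close>

lemma admissible_weight_measurable:
  "admissible_weight \<Omega> G w \<Longrightarrow> w \<in> borel_measurable (lebesgue_on \<Omega>)"
  by (auto simp: admissible_weight_def L_infty_def orlicz_def split: if_splits)

lemma normalized_young_imp_young_function: "normalized_young G \<Longrightarrow> young_function G"
  unfolding normalized_young_def young_function_def by blast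

theorem proposition3p4:
  fixes \<Omega> :: "'a::euclidean_space set" and G H :: "real \<Rightarrow> real" and w :: "'a \<Rightarrow> real"
    and \<mu>\<^sub>1 \<mu>\<^sub>2 :: real
  assumes "bounded_lipschitz_domain \<Omega>"
    and "normalized_young G" and "Delta_prime G"
    and "normalized_young H" and "Delta_prime H"
    and "T_crit DIM('a) G = \<infinity> \<Longrightarrow> young_less (\<lambda>t. ennreal (H t)) (crit_fun DIM('a) G)"
    and "admissible_weight \<Omega> G w"
    and "0 < \<mu>\<^sub>1" and "\<mu>\<^sub>1 < \<mu>\<^sub>2"
  shows "ennreal \<mu>\<^sub>1 * lambda1 \<Omega> G H w \<mu>\<^sub>1 \<le> ennreal \<mu>\<^sub>2 * lambda1 \<Omega> G H w \<mu>\<^sub>2"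
proof -
  have G: "young_function G" and H: "young_function H"
    using assms normalized_young_imp_young_function by auto
  let ?L = "ennreal \<mu>\<^sub>1 * lambda1 \<Omega> G H w \<mu>\<^sub>1"
  have pos: "0 < \<mu>\<^sub>2" using assms by linarith
  \<comment> \<open>This includes a = \<infinity>, since \<mu> is positive and finite.\<close>
  have cancel: "ennreal \<mu> * (a / ennreal \<mu>) = a" if "0 < \<mu>" for \<mu> a
    using that by (simp add: ennreal_times_divide ennreal_mult_divide_eq mult.commute)
  \<comment> \<open>Dividing by \<open>\<mu>\<^sub>2\<close> first turns the claim into a lower
    bound for an infimum, checked on each competitor. If there is none, the infimum is
    \<infinity>.\<close>
  have "?L / ennreal \<mu>\<^sub>2 \<le> lambda1 \<Omega> G H w \<mu>\<^sub>2"
    unfolding lambda1_def[of \<Omega> G H w \<mu>\<^sub>2]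
  proof (rule Inf_greatest, clarify)
    fix u v
    assume u: "u \<in> W1_0 \<Omega> G" and v: "weak_grad \<Omega> u v"
      and \<mu>2: "weighted_modular \<Omega> w H u = ennreal \<mu>\<^sub>2"
    have "u \<in> borel_measurable (lebesgue_on \<Omega>)"
      using u by (simp add: W1_0_def W1_def orlicz_def)
    moreover have "AE x in lebesgue_on \<Omega>. 0 \<le> w x"
      using assms by (simp add: admissible_weight_def)
    ultimately obtain c where c: "0 < c" "c \<le> 1"
      and \<mu>1: "weighted_modular \<Omega> w H (\<lambda>x. c * u x) = ennreal \<mu>\<^sub>1"
      using weighted_modular_intermediate[OF H admissible_weight_measurable[OF assms(7)]] \<mu>2 assms(8,9)
      by (metis less_imp_le)
    \<comment> \<open>The pair cu, cv competes for \<open>\<mu>\<^sub>1\<close>, and the constraint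
      fixes its denominator, which the factor \<open>\<mu>\<^sub>1\<close> then cancels.\<close>
    have "lambda1 \<Omega> G H w \<mu>\<^sub>1 \<le> modular \<Omega> G (\<lambda>x. norm (c *\<^sub>R v x)) / ennreal \<mu>\<^sub>1"
      unfolding lambda1_def
      using W1_0_scale[OF G c u] weak_grad_scale[OF v, of c] \<mu>1
      by (intro Inf_lower CollectI exI[of _ "\<lambda>x. c * u x"] exI[of _ "\<lambda>x. c *\<^sub>R v x"]) simp
    then have "?L \<le> ennreal \<mu>\<^sub>1 * (modular \<Omega> G (\<lambda>x. norm (c *\<^sub>R v x)) / ennreal \<mu>\<^sub>1)"
      by (rule mult_left_mono) simp
    also have "\<dots> = modular \<Omega> G (\<lambda>x. c * norm (v x))"
      using cancel[OF assms(8)] c by simp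
    also have "\<dots> \<le> modular \<Omega> G (\<lambda>x. norm (v x))"
      using c by (intro modular_scale_le[OF G]) auto
    finally show "?L / ennreal \<mu>\<^sub>2 \<le> modular \<Omega> G (\<lambda>x. norm (v x)) / weighted_modular \<Omega> w H u"
      unfolding \<mu>2 by (rule divide_right_mono_ennreal)
  qed
  then have "ennreal \<mu>\<^sub>2 * (?L / ennreal \<mu>\<^sub>2) \<le> ennreal \<mu>\<^sub>2 * lambda1 \<Omega> G H w \<mu>\<^sub>2"
    by (rule mult_left_mono) simp
  then show ?thesis
    using cancel[OF pos] by simp
qed

end
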